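(* Let $\Gamma$ be a metrized graph with $v$ vertices. Then $$(v-2)\, x(\Gamma) =\sum_{e_i \in E(\Gamma)}\frac{R_i}{L_i+R_i}\,x(\overline{\Gamma}_i), \qquad (v-2)\, y(\Gamma) =\sum_{e_i \in E(\Gamma)}\frac{R_i}{L_i+R_i}\,y(\overline{\Gamma}_i).$$
   Context: A metrized graph $\Gamma$ is a finite connected graph (multiple edges and self-loops allowed) each of whose edges is identified with a closed segment of positive length, with a finite nonempty vertex set $V(\Gamma)$ containing every point of valence $\neq2$; $v=\#V(\Gamma)$, $E(\Gamma)$ its edge set, $L_i$ the length of $e_i$. For an edge $e_i$ with end points $p_i,q_i$: if $\Gamma-e_i$ (interior deleted) is connected, $R_i$ is the effective resistance between $p_i,q_i$ in $\Gamma-e_i$ (edges as resistors of resistance equal to length), $R_{a_i,p}=\hat j_{p_i}(p,q_i)$, $R_{b_i,p}=\hat j_{q_i}(p,p_i)$, with $\hat j_z(x,y)$ the voltage function of $\Gamma-e_i$ (potential at $x$ when unit current enters at $y$ and exits at $z$, potential $0$ at $z$); if $e_i$ is a bridge, $R_{a_i,p}=0,R_{b_i,p}=R_i$ for $p$ in the component of $\Gamma-e_i$ containing $p_i$ and $R_{a_i,p}=R_i,R_{b_i,p}=0$ otherwise, with every expression in $R_i$ interpreted as its limit as $R_i\to\infty$; for a self-loop $R_i=0$. For a fixed vertex $p$ (the values are independent of $p$): $$y(\Gamma)=\frac14\sum_{e_i}\frac{L_iR_i^2}{(L_i+R_i)^2}+\frac34\sum_{e_i}\frac{L_i(R_{a_i,p}-R_{b_i,p})^2}{(L_i+R_i)^2},$$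 $$x(\Gamma)=\sum_{e_i}\frac{L_i^2R_i}{(L_i+R_i)^2}+\frac34\sum_{e_i}\frac{L_iR_i^2}{(L_i+R_i)^2}-\frac34\sum_{e_i}\frac{L_i(R_{a_i,p}-R_{b_i,p})^2}{(L_i+R_i)^2}.$$ $\overline\Gamma_i$ is obtained by contracting $e_i$ to a point, vertex set the image of $V(\Gamma)$; $x(\overline\Gamma_i),y(\overline\Gamma_i)$ are computed in $\overline\Gamma_i$. *)

theory Defs
  imports Complex_Main
begin

text \<open>A metrized graph is represented by a combinatorial model: a finite nonempty
vertex set V, a finite edge set E, endpoint maps s t (edge e joins s e and t e;
s e = t e for a self-loop; multiple edges allowed) and positive edge lengths L.\<close>

definition mg_adj :: "'e set \<Rightarrow> ('e \<Rightarrow> 'v) \<Rightarrow> ('e \<Rightarrow> 'v) \<Rightarrow> 'v \<Rightarrow> 'v \<Rightarrow> bool" where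
  "mg_adj E s t u w \<longleftrightarrow> (\<exists>e\<in>E. (s e = u \<and> t e = w) \<or> (s e = w \<and> t e = u))"

definition mg_reach :: "'e set \<Rightarrow> ('e \<Rightarrow> 'v) \<Rightarrow> ('e \<Rightarrow> 'v) \<Rightarrow> 'v \<Rightarrow> 'v \<Rightarrow> bool" where
  "mg_reach E s t u w \<longleftrightarrow> (mg_adj E s t)\<^sup>*\<^sup>* u w"

definition mg_connected :: "'v set \<Rightarrow> 'e set \<Rightarrow> ('e \<Rightarrow> 'v) \<Rightarrow> ('e \<Rightarrow> 'v) \<Rightarrow> bool" where
  "mg_connected V E s t \<longleftrightarrow> (\<forall>u\<in>V. \<forall>w\<in>V. mg_reach E s t u w)"

definition metrized_graph :: "'v set \<Rightarrow> 'e set \<Rightarrow> ('e \<Rightarrow> 'v) \<Rightarrow> ('e \<Rightarrow> 'v) \<Rightarrow> ('e \<Rightarrow> real) \<Rightarrow> bool" where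
  "metrized_graph V E s t L \<longleftrightarrow> finite V \<and> V \<noteq> {} \<and> finite E \<and>
     (\<forall>e\<in>E. s e \<in> V \<and> t e \<in> V \<and> L e > 0) \<and> mg_connected V E s t"

text \<open>Kirchhoff/Ohm characterisation of the voltage function: f is the potential
when unit current enters at y and exits at z, with f z = 0 (edges are resistors of
resistance equal to their length).\<close>

definition is_voltage :: "'v set \<Rightarrow> 'e set \<Rightarrow> ('e \<Rightarrow> 'v) \<Rightarrow> ('e \<Rightarrow> 'v) \<Rightarrow> ('e \<Rightarrow> real)
    \<Rightarrow> 'v \<Rightarrow> 'v \<Rightarrow> ('v \<Rightarrow> real) \<Rightarrow> bool" where
  "is_voltage V E s t L z y f \<longleftrightarrow> f z = 0 \<and> (\<forall>w. w \<notin> V \<longrightarrow> f w = 0) \<and>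
     (\<forall>w\<in>V. (\<Sum>e\<in>{e\<in>E. s e = w}. (f w - f (t e)) / L e)
           + (\<Sum>e\<in>{e\<in>E. t e = w}. (f w - f (s e)) / L e)
           = (if w = y then 1 else 0) - (if w = z then 1 else 0))"

definition jhat :: "'v set \<Rightarrow> 'e set \<Rightarrow> ('e \<Rightarrow> 'v) \<Rightarrow> ('e \<Rightarrow> 'v) \<Rightarrow> ('e \<Rightarrow> real)
    \<Rightarrow> 'v \<Rightarrow> 'v \<Rightarrow> 'v \<Rightarrow> real" where
  "jhat V E s t L z x y = (THE f. is_voltage V E s t L z y f) x"

definition is_bridge :: "'v set \<Rightarrow> 'e set \<Rightarrow> ('e \<Rightarrow> 'v) \<Rightarrow> ('e \<Rightarrow> 'v) \<Rightarrow> 'e \<Rightarrow> bool" where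
  "is_bridge V E s t e \<longleftrightarrow> \<not> mg_connected V (E - {e}) s t"

text \<open>R_i (non-bridge case): effective resistance between the end points in Gamma - e_i;
0 for a self-loop.\<close>
definition edge_R :: "'v set \<Rightarrow> 'e set \<Rightarrow> ('e \<Rightarrow> 'v) \<Rightarrow> ('e \<Rightarrow> 'v) \<Rightarrow> ('e \<Rightarrow> real) \<Rightarrow> 'e \<Rightarrow> real" where
  "edge_R V E s t L e = (if s e = t e then 0 else jhat V (E - {e}) s t L (t e) (s e) (s e))"

definition edge_Ra :: "'v set \<Rightarrow> 'e set \<Rightarrow> ('e \<Rightarrow> 'v) \<Rightarrow> ('e \<Rightarrow> 'v) \<Rightarrow> ('e \<Rightarrow> real) \<Rightarrow> 'v \<Rightarrow> 'e \<Rightarrow> real" where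
  "edge_Ra V E s t L p e = jhat V (E - {e}) s t L (s e) p (t e)"

definition edge_Rb :: "'v set \<Rightarrow> 'e set \<Rightarrow> ('e \<Rightarrow> 'v) \<Rightarrow> ('e \<Rightarrow> 'v) \<Rightarrow> ('e \<Rightarrow> real) \<Rightarrow> 'v \<Rightarrow> 'e \<Rightarrow> real" where
  "edge_Rb V E s t L p e = jhat V (E - {e}) s t L (t e) p (s e)"

definition y_term :: "real \<Rightarrow> real \<Rightarrow> real \<Rightarrow> real \<Rightarrow> real" where
  "y_term L R Ra Rb = 1/4 * (L * R\<^sup>2 / (L + R)\<^sup>2) + 3/4 * (L * (Ra - Rb)\<^sup>2 / (L + R)\<^sup>2)"

definition x_term :: "real \<Rightarrow> real \<Rightarrow> real \<Rightarrow> real \<Rightarrow> real" where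
  "x_term L R Ra Rb = L\<^sup>2 * R / (L + R)\<^sup>2 + 3/4 * (L * R\<^sup>2 / (L + R)\<^sup>2)
                      - 3/4 * (L * (Ra - Rb)\<^sup>2 / (L + R)\<^sup>2)"

text \<open>Per-edge value of an expression F(L_i,R_i,R_{a_i,p},R_{b_i,p}); for a bridge,
R_{a_i,p}, R_{b_i,p} are given in terms of R_i and the limit R_i \<rightarrow> \<infinity> is taken.\<close>
definition edge_val :: "(real \<Rightarrow> real \<Rightarrow> real \<Rightarrow> real \<Rightarrow> real) \<Rightarrow> 'v set \<Rightarrow> 'e set
    \<Rightarrow> ('e \<Rightarrow> 'v) \<Rightarrow> ('e \<Rightarrow> 'v) \<Rightarrow> ('e \<Rightarrow> real) \<Rightarrow> 'v \<Rightarrow> 'e \<Rightarrow> real" where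
  "edge_val F V E s t L p e =
     (if is_bridge V E s t e then
        (if mg_reach (E - {e}) s t (s e) p
         then Lim at_top (\<lambda>R. F (L e) R 0 R)
         else Lim at_top (\<lambda>R. F (L e) R R 0))
      else F (L e) (edge_R V E s t L e) (edge_Ra V E s t L p e) (edge_Rb V E s t L p e))"

definition y_inv :: "'v set \<Rightarrow> 'e set \<Rightarrow> ('e \<Rightarrow> 'v) \<Rightarrow> ('e \<Rightarrow> 'v) \<Rightarrow> ('e \<Rightarrow> real) \<Rightarrow> real" where
  "y_inv V E s t L = (let p = (SOME p. p \<in> V) in \<Sum>e\<in>E. edge_val y_term V E s t L p e)"

definition x_inv :: "'v set \<Rightarrow> 'e set \<Rightarrow> ('e \<Rightarrow> 'v) \<Rightarrow> ('e \<Rightarrow> 'v) \<Rightarrow> ('e \<Rightarrow> real) \<Rightarrow> real" where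
  "x_inv V E s t L = (let p = (SOME p. p \<in> V) in \<Sum>e\<in>E. edge_val x_term V E s t L p e)"

definition coef :: "'v set \<Rightarrow> 'e set \<Rightarrow> ('e \<Rightarrow> 'v) \<Rightarrow> ('e \<Rightarrow> 'v) \<Rightarrow> ('e \<Rightarrow> real) \<Rightarrow> 'e \<Rightarrow> real" where
  "coef V E s t L e =
     (if is_bridge V E s t e then Lim at_top (\<lambda>R. R / (L e + R))
      else edge_R V E s t L e / (L e + edge_R V E s t L e))"

text \<open>Contraction of edge e: the end point t e is identified with s e.  The contracted
graph has vertex set the image of V, edge set E - {e}, same lengths.\<close>
definition cmap :: "('e \<Rightarrow> 'v) \<Rightarrow> ('e \<Rightarrow> 'v) \<Rightarrow> 'e \<Rightarrow> 'v \<Rightarrow> 'v" where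
  "cmap s t e w = (if w = t e then s e else w)"

end

theory Submission
  imports Defs "HOL-Real_Asymp.Real_Asymp"
begin

text \<open>Let g be the Green function of the graph grounded at p, u_e = g(-,s e) - g(-,t e), and let
r_e = u_e(s e) - u_e(t e) be the effective resistance across e in the whole graph and
d_e = g(s e,s e) - g(t e,t e). Then R_i/(L_i+R_i) = r_e/L_e and
L_i(R_a-R_b)/(L_i+R_i) = d_e up to sign, also for bridges, so that
y = sum of (r_e^2 + 3 d_e^2)/(4 L_e) and x + y = sum of r_e. Summation by parts turns the former into
y = trace g - sum of (g(s e,s e) g(t e,t e) - g(s e,t e)^2)/L_e.
Contracting e replaces g by the rank one update g - u_e u_e^T/r_e. Since the u_e u_e^T/L_e sum
to g and the r_e/L_e sum to v-1 (Foster), averaging with weights r_e/L_e multiplies entries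
of g by v-2. A 2x2 minor is affine under a rank one update and is multiplied by v-3; the missing
minor is supplied by the trace, which loses the vertex t e on contraction.\<close>

section \<open>Finite linear systems over the reals\<close>

text \<open>Gaussian elimination, by induction on the equations: a nonzero coefficient
  \<open>A i j0\<close> of the new equation serves as pivot to eliminate the unknown
  \<open>j0\<close> from all others, which costs one equation and one unknown.\<close>

lemma underdetermined_system_nontrivial:
  fixes A :: "'i \<Rightarrow> 'j \<Rightarrow> real"
  assumes "finite I" "finite J" "card I < card J"
  shows "\<exists>h. (\<exists>j\<in>J. h j \<noteq> 0) \<and> (\<forall>i\<in>I. (\<Sum>j\<in>J. A i j * h j) = 0)"
  using assms
proof (induction I arbitrary: J A rule: finite_induct)
  case empty
  then have "J \<noteq> {}" by auto
  then show ?case by (intro exI[of _ "\<lambda>_. 1"]) auto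
next
  case (insert i I)
  show ?case
  proof (cases "\<forall>j\<in>J. A i j = 0")
    case True
    have "card I < card J" using insert by auto
    then obtain h where "\<exists>j\<in>J. h j \<noteq> 0" "\<forall>k\<in>I. (\<Sum>j\<in>J. A k j * h j) = 0"
      using insert.IH[of J A] insert.prems by blast
    then show ?thesis using True by (intro exI[of _ h]) auto
  next
    case False
    then obtain j0 where j0: "j0 \<in> J" "A i j0 \<noteq> 0" by blast
    define J' where "J' = J - {j0}"
    have J': "finite J'" "j0 \<notin> J'" "J = insert j0 J'" using insert.prems j0 by (auto simp: J'_def)
    have "card I < card J'" using insert J' by auto
    then obtain h where h: "\<exists>j\<in>J'. h j \<noteq> 0"
      and ker: "\<forall>k\<in>I. (\<Sum>j\<in>J'. (A k j - A k j0 * A i j / A i j0) * h j) = 0"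
      using insert.IH[of J' "\<lambda>k j. A k j - A k j0 * A i j / A i j0"] J'(1) by blast
    \<comment> \<open>The value of the eliminated unknown that equation \<open>i\<close>
      forces.\<close>
    define c where "c = - (\<Sum>j\<in>J'. A i j * h j) / A i j0"
    define h' where "h' = h(j0 := c)"
    have sum': "(\<Sum>j\<in>J. A k j * h' j) = A k j0 * c + (\<Sum>j\<in>J'. A k j * h j)" for k
    proof -
      have "(\<Sum>j\<in>J'. A k j * h' j) = (\<Sum>j\<in>J'. A k j * h j)"
        using J' by (intro sum.cong) (auto simp: h'_def)
      then show ?thesis using J' by (simp add: h'_def)
    qed
    have "(\<Sum>j\<in>J. A k j * h' j) = 0" if "k \<in> insert i I" for k
    proof (cases "k = i")
      case True
      then show ?thesis using j0 by (simp add: sum' c_def)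
    next
      case False
      then have "(\<Sum>j\<in>J'. (A k j - A k j0 * A i j / A i j0) * h j) = 0" using that ker by auto
      then have "(\<Sum>j\<in>J'. A k j * h j) - A k j0 * (\<Sum>j\<in>J'. A i j * h j) / A i j0 = 0"
        by (simp add: left_diff_distrib sum_subtractf sum_distrib_left sum_divide_distrib mult.assoc)
      then show ?thesis by (simp add: sum' c_def)
    qed
    moreover have "\<exists>j\<in>J. h' j \<noteq> 0" using h J' by (auto simp: h'_def)
    ultimately show ?thesis by blast
  qed
qed

text \<open>Adjoining \<open>- b\<close> as a column indexed by \<open>None\<close> gives more
  unknowns than equations, hence a nontrivial kernel vector. Injectivity prevents its
  \<open>None\<close> entry from vanishing, and dividing by that entry solves the system.\<close>

lemma square_system_solvable:
  fixes A :: "'i \<Rightarrow> 'i \<Rightarrow> real"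
  assumes "finite I"
    and inj: "\<And>h. (\<And>i. i \<in> I \<Longrightarrow> (\<Sum>j\<in>I. A i j * h j) = 0) \<Longrightarrow> \<forall>j\<in>I. h j = 0"
  shows "\<exists>h. \<forall>i\<in>I. (\<Sum>j\<in>I. A i j * h j) = b i"
proof -
  define J where "J = insert None (Some ` I)"
  define B where "B = (\<lambda>i k. case k of None \<Rightarrow> - b i | Some j \<Rightarrow> A i j)"
  have sumJ: "(\<Sum>k\<in>J. f k) = f None + (\<Sum>j\<in>I. f (Some j))" for f :: "_ \<Rightarrow> real"
    using assms(1) by (simp add: J_def sum.reindex)
  have "card J = Suc (card I)"
    using assms(1) by (simp add: J_def card_image)
  then obtain h where h: "\<exists>k\<in>J. h k \<noteq> 0" and ker: "\<forall>i\<in>I. (\<Sum>k\<in>J. B i k * h k) = 0"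
    using underdetermined_system_nontrivial[of I J B] assms(1) by (auto simp: J_def)
  have eq: "(\<Sum>j\<in>I. A i j * h (Some j)) = b i * h None" if "i \<in> I" for i
    using ker that by (auto simp: sumJ B_def)
  have "h None \<noteq> 0"
  proof
    assume 0: "h None = 0"
    then have "\<forall>j\<in>I. h (Some j) = 0" by (intro inj) (use eq in auto)
    then show False using h 0 by (auto simp: J_def)
  qed
  then show ?thesis using eq
    by (intro exI[of _ "\<lambda>j. h (Some j) / h None"]) (auto simp: sum_divide_distrib[symmetric])
qed

section \<open>The energy form and the Green function\<close>

text \<open>The energy form of the network with conductances \<open>1 / L e\<close>, that is, the
  weak form of the graph Laplacian.\<close>

definition dirichlet :: "'e set \<Rightarrow> ('e \<Rightarrow> 'v) \<Rightarrow> ('e \<Rightarrow> 'v) \<Rightarrow> ('e \<Rightarrow> real)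
    \<Rightarrow> ('v \<Rightarrow> real) \<Rightarrow> ('v \<Rightarrow> real) \<Rightarrow> real" where
  "dirichlet E s t L h f = (\<Sum>e\<in>E. (h (s e) - h (t e)) * (f (s e) - f (t e)) / L e)"

text \<open>The Green function grounded at p in weak form: the functions g(-,y) are only constrained
through their differences along edges, which suits deletion (drop one summand) and contraction
(restrict the test functions).\<close>

definition green :: "'v set \<Rightarrow> 'e set \<Rightarrow> ('e \<Rightarrow> 'v) \<Rightarrow> ('e \<Rightarrow> 'v) \<Rightarrow> ('e \<Rightarrow> real)
    \<Rightarrow> 'v \<Rightarrow> ('v \<Rightarrow> 'v \<Rightarrow> real) \<Rightarrow> bool" where
  "green V E s t L p g \<longleftrightarrow> p \<in> V \<and>
     (\<forall>y\<in>V. g p y = 0 \<and> (\<forall>h. dirichlet E s t L h (\<lambda>x. g x y) = h y - h p))"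

definition res :: "('e \<Rightarrow> 'v) \<Rightarrow> ('e \<Rightarrow> 'v) \<Rightarrow> ('v \<Rightarrow> 'v \<Rightarrow> real) \<Rightarrow> 'e \<Rightarrow> real" where
  "res s t g e = g (s e) (s e) + g (t e) (t e) - 2 * g (s e) (t e)"

definition ddiff :: "('e \<Rightarrow> 'v) \<Rightarrow> ('e \<Rightarrow> 'v) \<Rightarrow> ('v \<Rightarrow> 'v \<Rightarrow> real) \<Rightarrow> 'e \<Rightarrow> real" where
  "ddiff s t g e = g (s e) (s e) - g (t e) (t e)"

definition y_green :: "'e set \<Rightarrow> ('e \<Rightarrow> 'v) \<Rightarrow> ('e \<Rightarrow> 'v) \<Rightarrow> ('e \<Rightarrow> real)
    \<Rightarrow> ('v \<Rightarrow> 'v \<Rightarrow> real) \<Rightarrow> real" where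
  "y_green E s t L g = (\<Sum>e\<in>E. ((res s t g e)\<^sup>2 + 3 * (ddiff s t g e)\<^sup>2) / (4 * L e))"

lemma dirichlet_commute: "dirichlet E s t L h f = dirichlet E s t L f h"
  by (simp add: dirichlet_def mult.commute)

lemma dirichlet_diff: "dirichlet E s t L h (\<lambda>x. f x - k x) = dirichlet E s t L h f - dirichlet E s t L h k"
  by (simp add: dirichlet_def algebra_simps add_divide_distrib diff_divide_distrib sum.distrib sum_subtractf)

lemma dirichlet_scale: "dirichlet E s t L h (\<lambda>x. c * f x) = c * dirichlet E s t L h f"
  by (simp add: dirichlet_def sum_distrib_left algebra_simps)

lemma dirichlet_const [simp]: "dirichlet E s t L h (\<lambda>x. c) = 0"
  by (simp add: dirichlet_def)

lemma dirichlet_remove: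
  assumes "finite E" "e \<in> E"
  shows "dirichlet E s t L h f =
    (h (s e) - h (t e)) * (f (s e) - f (t e)) / L e + dirichlet (E - {e}) s t L h f"
  using assms by (simp add: dirichlet_def sum.remove)

text \<open>On \<open>V\<close>, \<open>h\<close> is a combination of the vertex indicators
  \<open>of_bool \<circ> (=) w\<close>. The factor of \<open>h w\<close> is the Laplacian of
  \<open>f\<close> at \<open>w\<close>, the net current leaving \<open>w\<close>.\<close>

lemma dirichlet_expand:
  assumes "finite V" "\<And>e. e \<in> E \<Longrightarrow> s e \<in> V \<and> t e \<in> V"
  shows "dirichlet E s t L h f = (\<Sum>w\<in>V. h w * dirichlet E s t L (of_bool \<circ> (=) w) f)"
proof -
  have "(\<Sum>w\<in>V. h w * dirichlet E s t L (of_bool \<circ> (=) w) f) =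
     (\<Sum>e\<in>E. \<Sum>w\<in>V. h w * ((of_bool (w = s e) - of_bool (w = t e)) * (f (s e) - f (t e)) / L e))"
    unfolding dirichlet_def sum_distrib_left by (subst sum.swap) simp
  also have "\<dots> = (\<Sum>e\<in>E. (\<Sum>w\<in>V. h w * (of_bool (w = s e) - of_bool (w = t e))) * (f (s e) - f (t e)) / L e)"
    by (simp add: sum_distrib_right sum_divide_distrib mult.assoc)
  also have "\<dots> = dirichlet E s t L h f"
    unfolding dirichlet_def using assms
    by (intro sum.cong) (auto simp: right_diff_distrib sum_subtractf)
  finally show ?thesis by simp
qed

text \<open>Links the energy form to Kirchhoff's law as it is written in \<open>is_voltage\<close>;
  a self-loop occurs in both sums with value 0.\<close>

lemma dirichlet_vertex:
  assumes "finite E"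
  shows "dirichlet E s t L (of_bool \<circ> (=) w) f =
    (\<Sum>e\<in>{e\<in>E. s e = w}. (f w - f (t e)) / L e) + (\<Sum>e\<in>{e\<in>E. t e = w}. (f w - f (s e)) / L e)"
  unfolding dirichlet_def sum.inter_filter[OF assms] sum.distrib[symmetric]
  by (intro sum.cong) (auto simp: diff_divide_distrib)

section \<open>Limits of the edge expressions at a bridge\<close>

text \<open>The two summands tend to l/4 and 3l/4. A bridge thus adds its whole length to y and, by
  cancellation of the 3/4 terms, nothing to x.\<close>

lemma y_term_tendsto:
  assumes "l > 0"
  shows "((\<lambda>R. y_term l R 0 R) \<longlongrightarrow> l) at_top" "((\<lambda>R. y_term l R R 0) \<longlongrightarrow> l) at_top"
  using assms unfolding y_term_def by (real_asymp simp: field_simps)+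

lemma x_term_tendsto:
  assumes "l > 0"
  shows "((\<lambda>R. x_term l R 0 R) \<longlongrightarrow> 0) at_top" "((\<lambda>R. x_term l R R 0) \<longlongrightarrow> 0) at_top"
  using assms unfolding x_term_def by (real_asymp simp: field_simps)+

lemma coef_tendsto:
  assumes "l > 0"
  shows "((\<lambda>R. R / (l + R)) \<longlongrightarrow> (1::real)) at_top"
  using assms by real_asymp

text \<open>Both values are the energy pairing of g(-,x) with g(-,y), which is symmetric.\<close>

lemma green_commute:
  assumes "green V E s t L p g" "x \<in> V" "y \<in> V"
  shows "g x y = g y x"
proof -
  have "dirichlet E s t L (\<lambda>w. g w x) (\<lambda>w. g w y) = g y x"
    "dirichlet E s t L (\<lambda>w. g w y) (\<lambda>w. g w x) = g x y"
    using assms by (auto simp: green_def)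
  then show ?thesis by (simp add: dirichlet_commute)
qed

section \<open>Reachability\<close>

lemma mg_reach_edge: "e \<in> E \<Longrightarrow> mg_reach E s t (s e) (t e)"
  unfolding mg_reach_def by (rule r_into_rtranclp) (auto simp: mg_adj_def)

lemma mg_reach_sym: "mg_reach E s t u w \<Longrightarrow> mg_reach E s t w u"
  unfolding mg_reach_def by (rule sympD[OF symp_rtranclp]) (auto simp: symp_def mg_adj_def)

lemma mg_reach_trans: "mg_reach E s t u w \<Longrightarrow> mg_reach E s t w x \<Longrightarrow> mg_reach E s t u x"
  unfolding mg_reach_def by (rule rtranclp_trans)

text \<open>Applied with the identity when an edge is deleted and with \<open>cmap\<close> when it
  is contracted.\<close>

lemma mg_reach_map:
  assumes edge: "\<And>e. e \<in> E \<Longrightarrow> mg_reach E' s' t' (\<phi> (s e)) (\<phi> (t e))"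
    and "mg_reach E s t u w"
  shows "mg_reach E' s' t' (\<phi> u) (\<phi> w)"
proof -
  have "(mg_adj E s t)\<^sup>*\<^sup>* u w" using assms(2) by (simp add: mg_reach_def)
  then show ?thesis
  proof induction
    case base
    then show ?case by (simp add: mg_reach_def)
  next
    case (step x y)
    then have "mg_reach E' s' t' (\<phi> x) (\<phi> y)"
      using edge mg_reach_sym by (fastforce simp: mg_adj_def)
    then show ?case using step.IH mg_reach_trans by metis
  qed
qed

section \<open>Existence of the Green function on a connected graph\<close>

locale metrized =
  fixes V :: "'v set" and E :: "'e set" and s t :: "'e \<Rightarrow> 'v" and L :: "'e \<Rightarrow> real"
  assumes metrized: "metrized_graph V E s t L"
begin

lemma finite_V: "finite V" and finite_E: "finite E"
  and ends: "e \<in> E \<Longrightarrow> s e \<in> V" "e \<in> E \<Longrightarrow> t e \<in> V"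
  and pos: "e \<in> E \<Longrightarrow> L e > 0"
  and connected: "u \<in> V \<Longrightarrow> w \<in> V \<Longrightarrow> mg_reach E s t u w"
  using metrized by (auto simp: metrized_graph_def mg_connected_def)

abbreviation D :: "('v \<Rightarrow> real) \<Rightarrow> ('v \<Rightarrow> real) \<Rightarrow> real" where
  "D \<equiv> dirichlet E s t L"

lemma dirichlet_nonneg: "D f f \<ge> 0"
  unfolding dirichlet_def using pos by (intro sum_nonneg) (simp add: less_imp_le)

lemma dirichlet_null:
  assumes "D f f = 0" "e \<in> E"
  shows "f (s e) = f (t e)"
proof -
  have "\<forall>e\<in>E. (f (s e) - f (t e)) * (f (s e) - f (t e)) / L e = 0"
    using assms(1) unfolding dirichlet_def
    by (subst (asm) sum_nonneg_eq_0_iff) (use finite_E pos in \<open>auto simp: less_imp_le\<close>)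
  then show ?thesis using assms(2) pos[OF assms(2)] by auto
qed

lemma dirichlet_null_const:
  assumes "D f f = 0" "u \<in> V" "w \<in> V"
  shows "f u = f w"
proof -
  have "(mg_adj E s t)\<^sup>*\<^sup>* u w" using connected[OF assms(2,3)] by (simp add: mg_reach_def)
  then show ?thesis
    by induction (use dirichlet_null[OF assms(1)] in \<open>auto simp: mg_adj_def\<close>)
qed

text \<open>The Laplacian kills constants, so its row at \<open>p\<close> is replaced by the
  grounding condition. A kernel vector of the new system has zero energy, hence is constant, hence
  0.\<close>

lemma potential_exists:
  assumes "p \<in> V" "y \<in> V"
  shows "\<exists>f. f p = 0 \<and> (\<forall>h. D h f = h y - h p)"
proof -
  define A where "A w x = (if w = p then of_bool (x = p) else D (of_bool \<circ> (=) w) (of_bool \<circ> (=) x))"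
    for w x
  have A_sum: "(\<Sum>x\<in>V. A w x * f x) = (if w = p then f p else D (of_bool \<circ> (=) w) f)" for w f
  proof (cases "w = p")
    case True
    then show ?thesis using assms finite_V by (simp add: A_def)
  next
    case False
    have "D (of_bool \<circ> (=) w) f = (\<Sum>x\<in>V. f x * D (of_bool \<circ> (=) x) (of_bool \<circ> (=) w))"
      by (subst dirichlet_commute, rule dirichlet_expand) (use finite_V ends in auto)
    also have "\<dots> = (\<Sum>x\<in>V. A w x * f x)"
      using False by (simp add: A_def dirichlet_commute mult.commute)
    finally show ?thesis using False by simp
  qed
  have expand: "D h f = (\<Sum>w\<in>V. h w * D (of_bool \<circ> (=) w) f)" for h f
    by (rule dirichlet_expand) (use finite_V ends in auto)
  have "\<exists>f. \<forall>w\<in>V. (\<Sum>x\<in>V. A w x * f x) = (if w = p then 0 else of_bool (w = y))"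
  proof (rule square_system_solvable[OF finite_V])
    fix f assume "\<And>w. w \<in> V \<Longrightarrow> (\<Sum>x\<in>V. A w x * f x) = 0"
    then have *: "f p = 0" "\<And>w. w \<in> V \<Longrightarrow> w \<noteq> p \<Longrightarrow> D (of_bool \<circ> (=) w) f = 0"
      using assms(1) unfolding A_sum by (metis, metis)
    have "D f f = 0" unfolding expand[of f] using * by (intro sum.neutral) (metis mult_eq_0_iff)
    then show "\<forall>j\<in>V. f j = 0" using dirichlet_null_const[OF _ assms(1)] *(1) by metis
  qed
  then obtain f where "\<forall>w\<in>V. (if w = p then f p else D (of_bool \<circ> (=) w) f) = (if w = p then 0 else of_bool (w = y))"
    unfolding A_sum by blast
  then have f: "f p = 0" "\<And>w. w \<in> V \<Longrightarrow> w \<noteq> p \<Longrightarrow> D (of_bool \<circ> (=) w) f = of_bool (w = y)"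
    using assms(1) by (metis, metis)
  have "D h f = h y - h p" for h
  proof -
    have "D h f = D (\<lambda>x. h x - h p) f"
      by (simp add: dirichlet_commute[of _ _ _ _ _ f] dirichlet_diff)
    also have "\<dots> = (\<Sum>w\<in>V. (h w - h p) * D (of_bool \<circ> (=) w) f)" by (rule expand)
    also have "\<dots> = (\<Sum>w\<in>V. if w = y then h w - h p else 0)"
    proof (intro sum.cong refl)
      fix w assume "w \<in> V"
      then show "(h w - h p) * D (of_bool \<circ> (=) w) f = (if w = y then h w - h p else 0)"
        using f(2)[of w] by (cases "w = p") simp_all
    qed
    also have "\<dots> = h y - h p" using assms finite_V by simp
    finally show ?thesis .
  qed
  then show ?thesis using f(1) by blast
qed

lemma green_exists:
  assumes "p \<in> V"
  shows "\<exists>g. green V E s t L p g"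
proof -
  have "\<forall>y\<in>V. \<exists>f. f p = 0 \<and> (\<forall>h. D h f = h y - h p)" using potential_exists[OF assms] by blast
  then obtain F where "\<forall>y\<in>V. F y p = 0 \<and> (\<forall>h. D h (F y) = h y - h p)" by metis
  then show ?thesis using assms
    by (intro exI[of _ "\<lambda>x y. F y x"]) (simp add: green_def)
qed

section \<open>Voltage functions in terms of the Green function\<close>

lemma is_voltage_iff:
  assumes "z \<in> V" "y \<in> V"
  shows "is_voltage V E s t L z y f \<longleftrightarrow>
    f z = 0 \<and> (\<forall>w. w \<notin> V \<longrightarrow> f w = 0) \<and> (\<forall>h. D h f = h y - h z)"
proof -
  have "(\<forall>w\<in>V. D (of_bool \<circ> (=) w) f = of_bool (w = y) - of_bool (w = z)) \<longleftrightarrow> (\<forall>h. D h f = h y - h z)"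
  proof
    assume *: "\<forall>w\<in>V. D (of_bool \<circ> (=) w) f = of_bool (w = y) - of_bool (w = z)"
    show "\<forall>h. D h f = h y - h z"
    proof
      fix h
      have "D h f = (\<Sum>w\<in>V. h w * D (of_bool \<circ> (=) w) f)"
        by (rule dirichlet_expand) (use finite_V ends in auto)
      also have "\<dots> = h y - h z"
        using * assms finite_V by (simp add: right_diff_distrib sum_subtractf)
      finally show "D h f = h y - h z" .
    qed
  qed simp
  then show ?thesis
    unfolding is_voltage_def dirichlet_vertex[OF finite_E] by (simp add: of_bool_def)
qed

text \<open>Superposition: g(-,y) - g(-,z) has source y and sink z, and subtracting its value at z
  grounds it there. Two solutions differ by a function of zero energy, which gives
  uniqueness.\<close>

lemma jhat_green:
  assumes g: "green V E s t L p g" and V: "x \<in> V" "y \<in> V" "z \<in> V"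
  shows "jhat V E s t L z x y = g x y - g x z - (g z y - g z z)"
proof -
  define f where "f x = (if x \<in> V then g x y - g x z - (g z y - g z z) else 0)" for x
  have "D h f = h y - h z" for h
  proof -
    have "D h f = D h (\<lambda>x. (g x y - g x z) - (g z y - g z z))"
      unfolding dirichlet_def by (intro sum.cong) (use ends in \<open>auto simp: f_def\<close>)
    also have "\<dots> = h y - h z"
      unfolding dirichlet_diff[of _ _ _ _ _ "\<lambda>x. g x y - g x z"]
      using g V by (simp add: dirichlet_diff green_def)
    finally show ?thesis .
  qed
  then have f: "is_voltage V E s t L z y f" using V by (simp add: is_voltage_iff f_def)
  have "f' = f" if "is_voltage V E s t L z y f'" for f'
  proof
    fix w
    have "D h (\<lambda>x. f' x - f x) = 0" for h
      using that f V by (simp add: is_voltage_iff dirichlet_diff)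
    then have "w \<in> V \<Longrightarrow> f' w - f w = f' z - f z"
      using dirichlet_null_const[of "\<lambda>x. f' x - f x" w z] V by blast
    then show "f' w = f w" using that f V by (cases "w \<in> V") (auto simp: is_voltage_iff)
  qed
  with f have "(THE f. is_voltage V E s t L z y f) = f" by (rule the_equality)
  then show ?thesis using V by (simp add: jhat_def f_def)
qed

section \<open>Independence of the base point\<close>

text \<open>g'(-,y) and g(-,y) - g(-,q) have the same source and sink, so their drops along
  \<open>e\<close> agree. The shift cancels in the second difference \<open>res\<close> and occurs
  twice in \<open>ddiff\<close>.\<close>

lemma green_rebase:
  assumes g: "green V E s t L p g" and g': "green V E s t L q g'" and e: "e \<in> E"
  shows "res s t g' e = res s t g e" "ddiff s t g' e = ddiff s t g e - 2 * (g (s e) q - g (t e) q)"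
proof -
  have q: "q \<in> V" using g' by (simp add: green_def)
  have diff: "g' (s e) y - g' (t e) y = g (s e) y - g (t e) y - (g (s e) q - g (t e) q)" if "y \<in> V" for y
  proof -
    have "D h (\<lambda>x. g' x y - (g x y - g x q)) = 0" for h
      using g g' q that by (simp add: green_def dirichlet_diff)
    from dirichlet_null[OF this e] show ?thesis by (simp add: algebra_simps)
  qed
  have st: "s e \<in> V" "t e \<in> V" using ends e by auto
  have "g' (s e) (t e) = g' (t e) (s e)" "g (s e) (t e) = g (t e) (s e)"
    using g g' st green_commute by metis+
  note * = this diff[OF st(1)] diff[OF st(2)]
  show "res s t g' e = res s t g e" using * unfolding res_def by linarith
  show "ddiff s t g' e = ddiff s t g e - 2 * (g (s e) q - g (t e) q)"
  proof -
    have "ddiff s t g' e = (g' (s e) (s e) - g' (t e) (s e)) + (g' (s e) (t e) - g' (t e) (t e))"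
      using *(1) by (simp add: ddiff_def)
    then show ?thesis unfolding *(3,4) using *(2) by (simp add: ddiff_def)
  qed
qed

text \<open>Along edges the diagonal of g' varies like d - w, where d is the diagonal of g and w = 2
  g(-,q). The energy of d survives because D(d,w) = 2 g(q,q) while D(w,w) = 4 g(q,q).\<close>

lemma y_green_rebase:
  assumes g: "green V E s t L p g" and g': "green V E s t L q g'"
  shows "y_green E s t L g' = y_green E s t L g"
proof -
  have V: "p \<in> V" "q \<in> V" using g g' by (auto simp: green_def)
  let ?w = "\<lambda>x. 2 * g x q" and ?d = "\<lambda>x. g x x"
  have w: "D h ?w = 2 * (h q - h p)" for h
    using g V unfolding dirichlet_scale by (simp add: green_def)
  have g0: "g p q = 0" "g p p = 0" using g V by (auto simp: green_def)
  have "(\<Sum>e\<in>E. (ddiff s t g' e)\<^sup>2 / L e) = D (\<lambda>x. ?d x - ?w x) (\<lambda>x. ?d x - ?w x)"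
    unfolding dirichlet_def
  proof (intro sum.cong refl)
    fix e assume "e \<in> E"
    then have "ddiff s t g' e = g (s e) (s e) - 2 * g (s e) q - (g (t e) (t e) - 2 * g (t e) q)"
      using green_rebase(2)[OF g g'] by (simp add: ddiff_def)
    then show "(ddiff s t g' e)\<^sup>2 / L e = (g (s e) (s e) - 2 * g (s e) q - (g (t e) (t e) - 2 * g (t e) q)) *
      (g (s e) (s e) - 2 * g (s e) q - (g (t e) (t e) - 2 * g (t e) q)) / L e"
      by (simp only: power2_eq_square)
  qed
  also have "\<dots> = D ?d ?d - 2 * D ?d ?w + D ?w ?w"
    by (simp add: dirichlet_diff dirichlet_commute[of _ _ _ _ "\<lambda>x. g x x - 2 * g x q"]
          dirichlet_commute[of _ _ _ _ ?w ?d])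
  also have "\<dots> = D ?d ?d" by (simp add: w g0)
  also have "\<dots> = (\<Sum>e\<in>E. (ddiff s t g e)\<^sup>2 / L e)"
    by (simp add: dirichlet_def ddiff_def power2_eq_square)
  finally have *: "(\<Sum>e\<in>E. (ddiff s t g' e)\<^sup>2 / L e) = (\<Sum>e\<in>E. (ddiff s t g e)\<^sup>2 / L e)" .
  have "y_green E s t L k = (\<Sum>e\<in>E. (res s t k e)\<^sup>2 / L e) / 4 + 3 / 4 * (\<Sum>e\<in>E. (ddiff s t k e)\<^sup>2 / L e)" for k
    by (simp add: y_green_def sum_divide_distrib sum_distrib_left sum.distrib[symmetric] add_divide_distrib mult.commute)
  then show ?thesis using * green_rebase(1)[OF g g'] by simp
qed

section \<open>Bridges, deletion of an edge, and the edge terms\<close>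

lemma res_ddiff_eq:
  assumes "green V E s t L p g" "e \<in> E"
  shows "res s t g e = (g (s e) (s e) - g (t e) (s e)) - (g (s e) (t e) - g (t e) (t e))"
    "ddiff s t g e = (g (s e) (s e) - g (t e) (s e)) + (g (s e) (t e) - g (t e) (t e))"
  using green_commute[OF assms(1) ends[OF assms(2)]] by (simp_all add: res_def ddiff_def)

text \<open>All current between the two sides of a bridge passes through it. The side containing
  \<open>p\<close> only affects the sign of \<open>ddiff\<close>, whence the square.\<close>

lemma res_bridge:
  assumes g: "green V E s t L p g" and e: "e \<in> E" and bridge: "is_bridge V E s t e"
  shows "res s t g e = L e" "(ddiff s t g e)\<^sup>2 = (L e)\<^sup>2"
proof -
  \<comment> \<open>testing with the indicator of the side of s e isolates the summand of e\<close>
  define h :: "'v \<Rightarrow> real" where "h w = of_bool (mg_reach (E - {e}) s t (s e) w)" for w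
  have h_s: "h (s e) = 1" by (simp add: h_def mg_reach_def)
  \<comment> \<open>If the ends of \<open>e\<close> were still joined, every path through
    \<open>e\<close> could be rerouted and the deletion would be connected.\<close>
  have h_t: "h (t e) = 0"
  proof (rule ccontr)
    assume "h (t e) \<noteq> 0"
    then have te: "mg_reach (E - {e}) s t (s e) (t e)" by (simp add: h_def split: if_splits)
    have "mg_reach (E - {e}) s t (s f) (t f)" if "f \<in> E" for f
      using that te mg_reach_edge[of f "E - {e}" s t] by (cases "f = e") auto
    then have "mg_reach (E - {e}) s t u w" if "u \<in> V" "w \<in> V" for u w
      using mg_reach_map[of E "E - {e}" s t "\<lambda>x. x" s t u w] connected that by simp
    then show False using bridge by (simp add: is_bridge_def mg_connected_def)
  qed
  have drop: "g (s e) y - g (t e) y = L e * (h y - h p)" if "y \<in> V" for y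
  proof -
    have "h (s f) = h (t f)" if "f \<in> E - {e}" for f
    proof -
      have "mg_reach (E - {e}) s t (s f) (t f)" using that by (rule mg_reach_edge)
      from mg_reach_trans[OF _ this] mg_reach_trans[OF _ mg_reach_sym[OF this]]
      have "mg_reach (E - {e}) s t (s e) (s f) \<longleftrightarrow> mg_reach (E - {e}) s t (s e) (t f)" by blast
      then show ?thesis by (simp add: h_def)
    qed
    then have "dirichlet (E - {e}) s t L h (\<lambda>x. g x y) = 0" by (simp add: dirichlet_def)
    then have "h y - h p = (g (s e) y - g (t e) y) / L e"
      using g that dirichlet_remove[OF finite_E e, of s t L h "\<lambda>x. g x y"] by (simp add: green_def h_s h_t)
    then show ?thesis using pos[OF e] by simp
  qed
  show "res s t g e = L e" "(ddiff s t g e)\<^sup>2 = (L e)\<^sup>2"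
    using ends[OF e]
    by (auto simp: res_ddiff_eq[OF g e] drop h_s h_t algebra_simps) (auto simp: h_def power2_eq_square)
qed

text \<open>Sherman--Morrison: adding e is a rank one perturbation of the Laplacian.\<close>

lemma green_undelete:
  assumes e: "e \<in> E" and g: "green V (E - {e}) s t L p g" and u: "\<And>x. u x = g x (s e) - g x (t e)"
    and LR: "L e + (u (s e) - u (t e)) \<noteq> 0"
  shows "green V E s t L p (\<lambda>x y. g x y - u x * u y / (L e + (u (s e) - u (t e))))"
proof -
  define K where "K = L e + (u (s e) - u (t e))"
  have K: "K \<noteq> 0" "u (s e) - u (t e) = K - L e" using LR by (auto simp: K_def)
  have V: "p \<in> V" "s e \<in> V" "t e \<in> V" using g ends e by (auto simp: green_def)
  have "D h (\<lambda>x. g x y - u x * u y / K) = h y - h p" if y: "y \<in> V" for h y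
  proof -
    have "dirichlet (E - {e}) s t L h (\<lambda>x. u y / K * u x) = u y / K * (h (s e) - h (t e))"
      unfolding dirichlet_scale using g V by (simp add: u dirichlet_diff green_def)
    then have 1: "dirichlet (E - {e}) s t L h (\<lambda>x. g x y - u x * u y / K) =
        h y - h p - u y / K * (h (s e) - h (t e))"
      using g y by (simp add: dirichlet_diff green_def mult.commute)
    have "g (s e) y - g (t e) y = u y"
      using green_commute[OF g] V y by (simp add: u)
    then have "(g (s e) y - u (s e) * u y / K) - (g (t e) y - u (t e) * u y / K) = u y - (u (s e) - u (t e)) * u y / K"
      by (simp add: algebra_simps diff_divide_distrib)
    also have "\<dots> = L e * u y / K" unfolding K(2) using K(1) by (simp add: field_simps)
    \<comment> \<open>The summand of \<open>e\<close> is (h(s e) - h(t e)) u(y) / K, exactly what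
      fact \<open>1\<close> lacks.\<close>
    finally show ?thesis
      using pos[OF e] by (simp add: dirichlet_remove[OF finite_E e] 1)
  qed
  then show ?thesis using g V by (simp add: green_def u K_def)
qed

text \<open>Off bridges, \<open>green_undelete\<close> turns data of the deletion into
  \<open>res\<close> = L R/(L+R), the law of parallel resistors, and \<open>ddiff\<close> = L (Ra -
  Rb)/(L+R). Moreover \<open>x_term\<close> + \<open>y_term\<close> = L R/(L+R).\<close>

lemma edge_val_green:
  assumes g: "green V E s t L p g" and e: "e \<in> E"
  shows "edge_val y_term V E s t L p e = ((res s t g e)\<^sup>2 + 3 * (ddiff s t g e)\<^sup>2) / (4 * L e)"
      (is "_ = ?y")
    and "edge_val x_term V E s t L p e = res s t g e - ((res s t g e)\<^sup>2 + 3 * (ddiff s t g e)\<^sup>2) / (4 * L e)"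
    and "coef V E s t L e = res s t g e / L e"
proof -
  note l = pos[OF e]
  have "edge_val y_term V E s t L p e = ?y \<and> edge_val x_term V E s t L p e = res s t g e - ?y
    \<and> coef V E s t L e = res s t g e / L e"
  proof (cases "is_bridge V E s t e")
    case True
    then have "?y = L e" using res_bridge[OF g e] l by (simp add: power2_eq_square)
    then show ?thesis using True l res_bridge(1)[OF g e]
      by (simp add: edge_val_def coef_def tendsto_Lim y_term_tendsto x_term_tendsto coef_tendsto)
  next
    case False
    interpret del: metrized V "E - {e}" s t L
      by unfold_locales (use metrized False in \<open>auto simp: metrized_graph_def is_bridge_def\<close>)
    have V: "p \<in> V" "s e \<in> V" "t e \<in> V" using g ends e by (auto simp: green_def)
    obtain k where k: "green V (E - {e}) s t L p k" using del.green_exists[OF V(1)] by blast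
    define u where "u x = k x (s e) - k x (t e)" for x
    define R where "R = u (s e) - u (t e)"
    have kp: "k x p = 0" "k p x = 0" if "x \<in> V" for x
      using k that V green_commute[OF k] by (auto simp: green_def)
    have kst: "k (s e) (t e) = k (t e) (s e)" using green_commute[OF k] V by simp
    have "dirichlet (E - {e}) s t L u u = R"
      unfolding u_def using k V by (simp add: dirichlet_diff green_def R_def u_def)
    then have R: "R \<ge> 0" using del.dirichlet_nonneg by metis
    \<comment> \<open>For a self-loop \<open>u\<close> vanishes, in accordance with the value 0 in
      \<open>edge_R\<close>.\<close>
    have eR: "edge_R V E s t L e = R" "edge_Ra V E s t L p e = u (s e)" "edge_Rb V E s t L p e = - u (t e)"
      using V by (auto simp: edge_R_def edge_Ra_def edge_Rb_def del.jhat_green[OF k] R_def u_def kp kst)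
    define g' where "g' x y = k x y - u x * u y / (L e + R)" for x y
    have "green V E s t L p g'"
      unfolding g'_def R_def by (rule green_undelete[OF e k]) (use R l in \<open>auto simp: u_def R_def\<close>)
    \<comment> \<open>Both Green functions are grounded at \<open>p\<close>, so the correction in
      \<open>ddiff\<close> is 0.\<close>
    from green_rebase[OF g this e]
    have "res s t g e = res s t g' e" "ddiff s t g e = ddiff s t g' e"
      using green_commute[OF g V(2,1)] green_commute[OF g V(3,1)] V g by (auto simp: green_def)
    moreover have "res s t g' e = R - R * R / (L e + R)"
      by (simp add: res_def g'_def kst) (simp add: R_def u_def kst algebra_simps diff_divide_distrib add_divide_distrib)
    moreover have "ddiff s t g' e = (u (s e) + u (t e)) - R * (u (s e) + u (t e)) / (L e + R)"
      by (simp add: ddiff_def g'_def) (simp add: R_def u_def kst algebra_simps diff_divide_distrib add_divide_distrib)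
    moreover have "X - R * X / (L e + R) = L e * X / (L e + R)" for X
      using R l by (simp add: field_simps)
    ultimately have rd: "res s t g e = L e * R / (L e + R)" "ddiff s t g e = L e * (u (s e) + u (t e)) / (L e + R)"
      by simp_all
    define K where "K = L e + R"
    define W where "W = u (s e) + u (t e)"
    have K: "K > 0" "R = K - L e" using R l by (auto simp: K_def)
    have "y_term (L e) R (u (s e)) (- u (t e)) = ((L e * R / K)\<^sup>2 + 3 * (L e * W / K)\<^sup>2) / (4 * L e)"
    proof -
      have "y_term (L e) R (u (s e)) (- u (t e)) = 1/4 * (L e * R\<^sup>2 / K\<^sup>2) + 3/4 * (L e * W\<^sup>2 / K\<^sup>2)"
        by (simp add: y_term_def K_def W_def)
      also have "\<dots> = ((L e * R / K)\<^sup>2 + 3 * (L e * W / K)\<^sup>2) / (4 * L e)"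
        using K(1) l by (simp add: field_simps power2_eq_square)
      finally show ?thesis .
    qed
    moreover have "x_term (L e) R a b = L e * R / K - y_term (L e) R a b" for a b
    proof -
      have "x_term (L e) R a b + y_term (L e) R a b = (L e)\<^sup>2 * R / K\<^sup>2 + L e * R\<^sup>2 / K\<^sup>2"
        by (simp add: x_term_def y_term_def K_def)
      also have "\<dots> = L e * R * K / K\<^sup>2"
        by (simp add: K_def add_divide_distrib[symmetric] power2_eq_square algebra_simps)
      also have "\<dots> = L e * R / K" using K(1) by (simp add: power2_eq_square)
      finally show ?thesis by simp
    qed
    ultimately show ?thesis using False l rd
      by (simp add: edge_val_def coef_def eR K_def W_def)
  qed
  then show "edge_val y_term V E s t L p e = ?y" "edge_val x_term V E s t L p e = res s t g e - ?y"
    "coef V E s t L e = res s t g e / L e" by blast+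
qed

text \<open>Frees the invariants from the base vertex chosen in their definitions.\<close>

lemma inv_green:
  assumes "green V E s t L p g"
  shows "y_inv V E s t L = y_green E s t L g"
    and "x_inv V E s t L = (\<Sum>e\<in>E. res s t g e) - y_green E s t L g"
proof -
  define q where "q = (SOME q. q \<in> V)"
  have "q \<in> V" using assms unfolding q_def green_def by (metis someI)
  then obtain k where k: "green V E s t L q k" using green_exists by blast
  have "y_inv V E s t L = y_green E s t L k"
    unfolding y_inv_def Let_def q_def[symmetric] y_green_def
    by (intro sum.cong refl edge_val_green k)
  moreover have "x_inv V E s t L = (\<Sum>e\<in>E. res s t k e) - y_green E s t L k"
    unfolding x_inv_def Let_def q_def[symmetric] y_green_def sum_subtractf[symmetric]
    by (intro sum.cong refl edge_val_green k)
  moreover have "(\<Sum>e\<in>E. res s t k e) = (\<Sum>e\<in>E. res s t g e)"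
    by (intro sum.cong refl green_rebase(1)[OF assms k])
  ultimately show "y_inv V E s t L = y_green E s t L g"
    "x_inv V E s t L = (\<Sum>e\<in>E. res s t g e) - y_green E s t L g"
    using y_green_rebase[OF assms k] by simp_all
qed

section \<open>Summation by parts, Foster's theorem and the trace formula\<close>

text \<open>The Laplacian of g(-,x) at x is 1, or 0 if x = p. Weighting by \<open>\<phi>\<close> and
  exchanging the sums leaves on each edge the contributions of its two ends. The choice 1 yields
  Foster's theorem, the diagonal of g the trace formula.\<close>

lemma green_vertex_sum:
  assumes g: "green V E s t L p g"
  shows "(\<Sum>e\<in>E. (\<phi> (s e) * (g (s e) (s e) - g (t e) (s e)) - \<phi> (t e) * (g (s e) (t e) - g (t e) (t e))) / L e)
    = (\<Sum>x\<in>V. \<phi> x) - \<phi> p"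
proof -
  have delta: "(\<Sum>x\<in>V. of_bool (x = a) * F x) = F a" if "a \<in> V" for a and F :: "'v \<Rightarrow> real"
    using that finite_V by simp
  have "(\<Sum>x\<in>V. \<phi> x) - \<phi> p = (\<Sum>x\<in>V. \<phi> x * D (of_bool \<circ> (=) x) (\<lambda>w. g w x))"
    using g finite_V by (simp add: green_def right_diff_distrib sum_subtractf)
  also have "\<dots> = (\<Sum>e\<in>E. \<Sum>x\<in>V. \<phi> x * ((of_bool (x = s e) - of_bool (x = t e)) * (g (s e) x - g (t e) x) / L e))"
    unfolding dirichlet_def sum_distrib_left by (subst sum.swap) simp
  also have "\<dots> = (\<Sum>e\<in>E. \<Sum>x\<in>V. of_bool (x = s e) * (\<phi> x * (g (s e) x - g (t e) x) / L e)
      - of_bool (x = t e) * (\<phi> x * (g (s e) x - g (t e) x) / L e))"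
    by (simp add: algebra_simps diff_divide_distrib add_divide_distrib)
  also have "\<dots> = (\<Sum>e\<in>E. (\<phi> (s e) * (g (s e) (s e) - g (t e) (s e)) - \<phi> (t e) * (g (s e) (t e) - g (t e) (t e))) / L e)"
    unfolding sum_subtractf delta[OF ends(1)] delta[OF ends(2)]
    by (simp add: delta ends sum_subtractf diff_divide_distrib del: times_divide_eq_right)
  finally show ?thesis ..
qed

lemma foster:
  assumes g: "green V E s t L p g"
  shows "(\<Sum>e\<in>E. res s t g e / L e) = real (card V) - 1"
  using green_vertex_sum[OF g, of "\<lambda>_. 1"] by (simp add: res_ddiff_eq[OF g])

text \<open>The reproducing property of g for the energy form, read as a sum of rank one matrices
  over the edges.\<close>

lemma green_square_sum:
  assumes g: "green V E s t L p g" and V: "x \<in> V" "y \<in> V"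
  shows "(\<Sum>e\<in>E. (g x (s e) - g x (t e)) * (g y (s e) - g y (t e)) / L e) = g x y"
proof -
  have "(\<Sum>e\<in>E. (g x (s e) - g x (t e)) * (g y (s e) - g y (t e)) / L e) = D (\<lambda>w. g w x) (\<lambda>w. g w y)"
    unfolding dirichlet_def
    by (intro sum.cong refl) (simp add: green_commute[OF g V(1)] green_commute[OF g V(2)] ends)
  also have "\<dots> = g y x" using g V by (simp add: green_def)
  finally show ?thesis using green_commute[OF g V] by simp
qed

text \<open>Adding its 2x2 minor to the y-summand of an edge gives the summand of
  \<open>green_vertex_sum\<close> for the diagonal of g; the total is the trace since g(p,p) =
  0.\<close>

lemma y_green_trace:
  assumes g: "green V E s t L p g"
  shows "y_green E s t L g =
    (\<Sum>x\<in>V. g x x) - (\<Sum>e\<in>E. (g (s e) (s e) * g (t e) (t e) - (g (s e) (t e))\<^sup>2) / L e)"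
proof -
  have p: "g p p = 0" using g by (simp add: green_def)
  have "y_green E s t L g + (\<Sum>e\<in>E. (g (s e) (s e) * g (t e) (t e) - (g (s e) (t e))\<^sup>2) / L e)
    = (\<Sum>e\<in>E. (g (s e) (s e) * (g (s e) (s e) - g (t e) (s e)) - g (t e) (t e) * (g (s e) (t e) - g (t e) (t e))) / L e)"
    unfolding y_green_def sum.distrib[symmetric]
  proof (intro sum.cong refl)
    fix e assume e: "e \<in> E"
    have c: "g (t e) (s e) = g (s e) (t e)" using green_commute[OF g] ends[OF e] by simp
    have "(res s t g e)\<^sup>2 + 3 * (ddiff s t g e)\<^sup>2 + 4 * (g (s e) (s e) * g (t e) (t e) - (g (s e) (t e))\<^sup>2) =
      4 * (g (s e) (s e) * (g (s e) (s e) - g (t e) (s e)) - g (t e) (t e) * (g (s e) (t e) - g (t e) (t e)))"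
      unfolding res_def ddiff_def c by algebra
    moreover have "a / (4 * L e) + m / L e = (a + 4 * m) / (4 * L e)" for a m
      by (simp add: add_divide_distrib)
    ultimately show "((res s t g e)\<^sup>2 + 3 * (ddiff s t g e)\<^sup>2) / (4 * L e) + (g (s e) (s e) * g (t e) (t e) - (g (s e) (t e))\<^sup>2) / L e
      = (g (s e) (s e) * (g (s e) (s e) - g (t e) (s e)) - g (t e) (t e) * (g (s e) (t e) - g (t e) (t e))) / L e"
      by (simp only:)
  qed
  also have "\<dots> = (\<Sum>x\<in>V. g x x)"
    using green_vertex_sum[OF g, of "\<lambda>x. g x x"] p by simp
  finally show ?thesis by simp
qed

text \<open>\<open>res\<close> is the energy of \<open>?u\<close>. If it were 0, \<open>?u\<close>
  would pair to 0 with the indicator of \<open>s e\<close>, but that pairing is 1.\<close>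

lemma res_pos:
  assumes g: "green V E s t L p g" and e: "e \<in> E" and ne: "s e \<noteq> t e"
  shows "res s t g e > 0"
proof -
  let ?u = "\<lambda>x. g x (s e) - g x (t e)"
  have V: "s e \<in> V" "t e \<in> V" using ends e by auto
  have D_u: "D h ?u = h (s e) - h (t e)" for h
    using g V by (simp add: dirichlet_diff green_def)
  have "D ?u ?u = res s t g e" unfolding D_u using res_ddiff_eq(1)[OF g e] by simp
  moreover have "D ?u ?u \<noteq> 0"
  proof
    assume "D ?u ?u = 0"
    then have "D (of_bool \<circ> (=) (s e)) ?u = 0"
      unfolding dirichlet_def[of E s t L "of_bool \<circ> _"] using dirichlet_null by (intro sum.neutral) auto
    then show False using ne by (simp add: D_u)
  qed
  ultimately show ?thesis using dirichlet_nonneg[of ?u] by simp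
qed

section \<open>Contraction of an edge\<close>

lemma metrized_contract:
  assumes e: "e \<in> E"
  shows "metrized (cmap s t e ` V) (E - {e}) (cmap s t e \<circ> s) (cmap s t e \<circ> t) L"
proof
  let ?c = "cmap s t e"
  have "mg_reach (E - {e}) (?c \<circ> s) (?c \<circ> t) (?c (s f)) (?c (t f))" if "f \<in> E" for f
  proof (cases "f = e")
    case True
    then show ?thesis by (simp add: cmap_def mg_reach_def)
  next
    case False
    then show ?thesis using mg_reach_edge[of f "E - {e}" "?c \<circ> s" "?c \<circ> t"] that by simp
  qed
  then have "mg_connected (?c ` V) (E - {e}) (?c \<circ> s) (?c \<circ> t)"
    using connected mg_reach_map[of E "E - {e}" "?c \<circ> s" "?c \<circ> t" ?c s t] by (auto simp: mg_connected_def)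
  then show "metrized_graph (?c ` V) (E - {e}) (?c \<circ> s) (?c \<circ> t) L"
    using metrized by (auto simp: metrized_graph_def)
qed

text \<open>Green function after contraction of e; for a self-loop the division by zero makes it g itself.\<close>

definition contr :: "('v \<Rightarrow> 'v \<Rightarrow> real) \<Rightarrow> 'e \<Rightarrow> 'v \<Rightarrow> 'v \<Rightarrow> real" where
  "contr g e x y = g x y - (g x (s e) - g x (t e)) * (g y (s e) - g y (t e)) / res s t g e"

text \<open>The correction removes exactly the drop across \<open>e\<close> from every row, so the
  rows of the two ends coincide; by symmetry so do the columns, and \<open>contr g e\<close>
  descends to the quotient.\<close>

lemma contr_cmap:
  assumes g: "green V E s t L p g" and e: "e \<in> E" and ne: "s e \<noteq> t e" and V: "x \<in> V" "y \<in> V"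
  shows "contr g e (cmap s t e x) (cmap s t e y) = contr g e x y"
proof -
  have *: "contr g e (t e) y = contr g e (s e) y" if "y \<in> V" for y
  proof -
    have "g (s e) y - g (t e) y = g y (s e) - g y (t e)"
      using green_commute[OF g that] ends[OF e] by simp
    moreover have "contr g e (s e) y - contr g e (t e) y = g (s e) y - g (t e) y
      - ((g (s e) (s e) - g (s e) (t e)) - (g (t e) (s e) - g (t e) (t e))) * (g y (s e) - g y (t e)) / res s t g e"
      by (simp add: contr_def algebra_simps diff_divide_distrib add_divide_distrib)
    moreover have "(g (s e) (s e) - g (s e) (t e)) - (g (t e) (s e) - g (t e) (t e)) = res s t g e"
      using res_ddiff_eq(1)[OF g e] by simp
    ultimately show ?thesis using res_pos[OF g e ne] by simp
  qed
  have sym: "contr g e x y = contr g e y x" if "x \<in> V" "y \<in> V" for x y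
    using green_commute[OF g that] by (simp add: contr_def mult.commute)
  have "contr g e (cmap s t e x) z = contr g e x z" if "z \<in> V" for z x
    using *[OF that] by (simp add: cmap_def)
  moreover have "cmap s t e x \<in> V" if "x \<in> V" for x using that ends[OF e] by (simp add: cmap_def)
  ultimately show ?thesis using sym V by metis
qed

text \<open>Test functions \<open>h \<circ> ?c\<close> take equal values at the ends of
  \<open>e\<close>. For them the summand of \<open>e\<close> vanishes, and so does the pairing with
  the correction, a multiple of \<open>?u\<close>.\<close>

lemma green_contract:
  assumes g: "green V E s t L p g" and e: "e \<in> E" and ne: "s e \<noteq> t e"
  shows "green (cmap s t e ` V) (E - {e}) (cmap s t e \<circ> s) (cmap s t e \<circ> t) L (cmap s t e p) (contr g e)"
proof -
  let ?c = "cmap s t e"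
  have V: "p \<in> V" "s e \<in> V" "t e \<in> V" using g ends e by (auto simp: green_def)
  note cc = contr_cmap[OF g e ne]
  have "contr g e (?c p) (?c y) = 0" if "y \<in> V" for y
    unfolding cc[OF V(1) that] using g V that by (simp add: contr_def green_def)
  moreover have "dirichlet (E - {e}) (?c \<circ> s) (?c \<circ> t) L h (\<lambda>x. contr g e x (?c y)) = h (?c y) - h (?c p)"
    if y: "y \<in> V" for h y
  proof -
    let ?u = "\<lambda>x. g x (s e) - g x (t e)"
    have ste: "?c (s e) = ?c (t e)" by (simp add: cmap_def)
    have "dirichlet (E - {e}) (?c \<circ> s) (?c \<circ> t) L h (\<lambda>x. contr g e x (?c y)) =
        dirichlet (E - {e}) s t L (h \<circ> ?c) (\<lambda>x. contr g e x y)"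
      unfolding dirichlet_def by (intro sum.cong refl) (use ends y in \<open>simp add: cc\<close>)
    also have "\<dots> = D (h \<circ> ?c) (\<lambda>x. contr g e x y)"
      by (simp add: dirichlet_remove[OF finite_E e] ste)
    also have "\<dots> = D (h \<circ> ?c) (\<lambda>x. g x y - ?u y / res s t g e * ?u x)"
      by (simp add: contr_def mult.commute)
    also have "\<dots> = D (h \<circ> ?c) (\<lambda>x. g x y) - ?u y / res s t g e * D (h \<circ> ?c) ?u"
      by (simp only: dirichlet_diff[of _ _ _ _ _ "\<lambda>x. g x y"] dirichlet_scale)
    also have "\<dots> = h (?c y) - h (?c p)"
      using g V y by (simp add: dirichlet_diff green_def ste)
    finally show ?thesis .
  qed
  ultimately show ?thesis using V by (simp add: green_def)
qed

section \<open>Weighted sums over all contractions\<close>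

text \<open>The weight clears the denominator of \<open>contr\<close>, so that self-loops fit the
  same formula with both sides 0.\<close>

lemma contr_scaled:
  assumes g: "green V E s t L p g" and e: "e \<in> E"
  shows "res s t g e / L e * contr g e x y =
    res s t g e / L e * g x y - (g x (s e) - g x (t e)) * (g y (s e) - g y (t e)) / L e"
proof (cases "s e = t e")
  case False
  then have "res s t g e \<noteq> 0" using res_pos[OF g e] by simp
  then show ?thesis by (simp add: contr_def right_diff_distrib diff_divide_distrib)
qed (simp add: res_def)

lemma contr_sum:
  assumes g: "green V E s t L p g" and V: "x \<in> V" "y \<in> V"
  shows "(\<Sum>e\<in>E. res s t g e / L e * contr g e x y) = (real (card V) - 2) * g x y"
proof -
  have "(\<Sum>e\<in>E. res s t g e / L e * contr g e x y) = (\<Sum>e\<in>E. res s t g e / L e) * g x y - g x y"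
    using green_square_sum[OF g V] by (simp add: contr_scaled[OF g] sum_subtractf sum_distrib_right del: times_divide_eq_left)
  then show ?thesis by (simp add: foster[OF g] algebra_simps)
qed

text \<open>In the minor the terms with the squared denominator cancel, so a single factor
  \<open>res\<close> clears all denominators.\<close>

lemma contr_minor_scaled:
  assumes g: "green V E s t L p g" and e: "e \<in> E"
  shows "res s t g e / L e * (contr g e x x * contr g e y y - (contr g e x y)\<^sup>2) =
    res s t g e / L e * (g x x * g y y - (g x y)\<^sup>2)
    - ((g x (s e) - g x (t e)) * (g x (s e) - g x (t e)) / L e * g y y
     + (g y (s e) - g y (t e)) * (g y (s e) - g y (t e)) / L e * g x x
     - 2 * ((g x (s e) - g x (t e)) * (g y (s e) - g y (t e)) / L e * g x y))"
proof (cases "s e = t e")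
  case True
  then show ?thesis by (simp add: res_def)
next
  case False
  define r where "r = res s t g e"
  define a where "a = g x (s e) - g x (t e)"
  define b where "b = g y (s e) - g y (t e)"
  have r: "r \<noteq> 0" using res_pos[OF g e False] by (simp add: r_def)
  have "r * ((g x x - a * a / r) * (g y y - b * b / r) - (g x y - a * b / r)\<^sup>2) =
    r * (g x x * g y y - (g x y)\<^sup>2) - (a * a * g y y + b * b * g x x - 2 * (a * b * g x y))"
    using r by (simp add: field_simps power2_eq_square)
  then have "r / l * ((g x x - a * a / r) * (g y y - b * b / r) - (g x y - a * b / r)\<^sup>2) =
    r / l * (g x x * g y y - (g x y)\<^sup>2) - (a * a / l * g y y + b * b / l * g x x - 2 * (a * b / l * g x y))"
    for l by (simp only: times_divide_eq_left times_divide_eq_right diff_divide_distrib add_divide_distrib)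
  then show ?thesis
    unfolding contr_def r_def a_def b_def by blast
qed

text \<open>By \<open>green_square_sum\<close> the corrections add up to twice the minor, which
  takes v-1 from Foster's theorem to v-3.\<close>

lemma contr_minor_sum:
  assumes g: "green V E s t L p g" and V: "x \<in> V" "y \<in> V"
  shows "(\<Sum>e\<in>E. res s t g e / L e * (contr g e x x * contr g e y y - (contr g e x y)\<^sup>2))
    = (real (card V) - 3) * (g x x * g y y - (g x y)\<^sup>2)"
proof -
  have "(\<Sum>e\<in>E. res s t g e / L e * (contr g e x x * contr g e y y - (contr g e x y)\<^sup>2)) =
    (\<Sum>e\<in>E. res s t g e / L e) * (g x x * g y y - (g x y)\<^sup>2)
    - (g x x * g y y + g y y * g x x - 2 * (g x y * g x y))"
    by (simp add: contr_minor_scaled[OF g] sum_subtractf sum.distrib sum_distrib_left[symmetric]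
        sum_distrib_right[symmetric] green_square_sum[OF g] V del: times_divide_eq_left)
  then show ?thesis by (simp add: foster[OF g] algebra_simps power2_eq_square)
qed

definition minor :: "('v \<Rightarrow> 'v \<Rightarrow> real) \<Rightarrow> 'e \<Rightarrow> real" where
  "minor g e = g (s e) (s e) * g (t e) (t e) - (g (s e) (t e))\<^sup>2"

text \<open>Rewrites the invariants of a contraction as sums over all of \<open>V\<close> and
  \<open>E\<close>, so that the sums over contractions can be exchanged with them. The term
  \<open>minor g e / L e\<close> is the price of the lost vertex \<open>t e\<close>. A self-loop has
  weight 0.\<close>

lemma contract_inv:
  assumes g: "green V E s t L p g" and e: "e \<in> E"
  defines "c \<equiv> cmap s t e"
  shows "res s t g e / L e * y_inv (c ` V) (E - {e}) (c \<circ> s) (c \<circ> t) L =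
      res s t g e / L e * ((\<Sum>x\<in>V. contr g e x x) - (\<Sum>f\<in>E. minor (contr g e) f / L f)) - minor g e / L e"
      (is ?y)
    and "res s t g e / L e * x_inv (c ` V) (E - {e}) (c \<circ> s) (c \<circ> t) L =
      res s t g e / L e * (\<Sum>f\<in>E. res s t (contr g e) f)
      - res s t g e / L e * y_inv (c ` V) (E - {e}) (c \<circ> s) (c \<circ> t) L" (is ?x)
proof -
  have "?y \<and> ?x"
  proof (cases "s e = t e")
    case True
    then show ?thesis by (simp add: res_def minor_def power2_eq_square)
  next
    case False
    have V: "p \<in> V" "s e \<in> V" "t e \<in> V" using g ends e by (auto simp: green_def)
    interpret con: metrized "c ` V" "E - {e}" "c \<circ> s" "c \<circ> t" L
      unfolding c_def by (rule metrized_contract[OF e])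
    note gc = green_contract[OF g e False, folded c_def]
    note cc = contr_cmap[OF g e False, folded c_def]
    have cV: "c ` V = V - {t e}" using V False by (auto simp: c_def cmap_def image_iff)
    have c_st: "c (s e) = c (t e)" by (simp add: c_def cmap_def)
    \<comment> \<open>All entries at the ends of \<open>e\<close> agree, so \<open>e\<close> has
      zero minor and zero resistance and may be put back into the sums.\<close>
    have cst: "contr g e (s e) (s e) = contr g e (t e) (t e)" "contr g e (s e) (t e) = contr g e (t e) (t e)"
      using cc V c_st by metis+
    have E0: "(\<Sum>f\<in>E. F f) = (\<Sum>f\<in>E - {e}. F f)" if "F e = 0" for F :: "'e \<Rightarrow> real"
      using that finite_E e by (simp add: sum.remove)
    have "(\<Sum>f\<in>E - {e}. (contr g e ((c \<circ> s) f) ((c \<circ> s) f) * contr g e ((c \<circ> t) f) ((c \<circ> t) f)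
        - (contr g e ((c \<circ> s) f) ((c \<circ> t) f))\<^sup>2) / L f) = (\<Sum>f\<in>E - {e}. minor (contr g e) f / L f)"
      by (intro sum.cong) (use ends in \<open>auto simp: minor_def cc\<close>)
    also have "\<dots> = (\<Sum>f\<in>E. minor (contr g e) f / L f)"
      by (rule E0[symmetric]) (simp add: minor_def cst power2_eq_square)
    finally have y: "y_inv (c ` V) (E - {e}) (c \<circ> s) (c \<circ> t) L =
        (\<Sum>x\<in>V. contr g e x x) - contr g e (t e) (t e) - (\<Sum>f\<in>E. minor (contr g e) f / L f)"
      using con.inv_green(1)[OF gc] con.y_green_trace[OF gc] V finite_V
      by (simp add: cV sum_diff1)
    have "res s t g e * contr g e (t e) (t e) = minor g e"
    proof -
      have "res s t g e * contr g e (t e) (t e) =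
          res s t g e * g (t e) (t e) - (g (t e) (s e) - g (t e) (t e)) * (g (t e) (s e) - g (t e) (t e))"
        using res_pos[OF g e False] by (simp add: contr_def right_diff_distrib[of "res s t g e"])
      also have "\<dots> = minor g e"
        unfolding res_def minor_def green_commute[OF g V(3,2)] by algebra
      finally show ?thesis .
    qed
    then have ?y unfolding y by (simp add: algebra_simps diff_divide_distrib)
    have "(\<Sum>f\<in>E - {e}. res (c \<circ> s) (c \<circ> t) (contr g e) f) = (\<Sum>f\<in>E - {e}. res s t (contr g e) f)"
      by (intro sum.cong) (use ends in \<open>auto simp: res_def cc\<close>)
    also have "\<dots> = (\<Sum>f\<in>E. res s t (contr g e) f)"
      by (rule E0[symmetric]) (simp add: res_def cst)
    finally have ?x using con.inv_green[OF gc] by (simp add: right_diff_distrib)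
    with \<open>?y\<close> show ?thesis by blast
  qed
  then show ?y ?x by blast+
qed

section \<open>The contraction identities for x and y\<close>

lemma contraction_identities:
  defines "c \<equiv> cmap s t"
  shows "(real (card V) - 2) * x_inv V E s t L =
      (\<Sum>e\<in>E. coef V E s t L e * x_inv (c e ` V) (E - {e}) (c e \<circ> s) (c e \<circ> t) L)" (is "?x = ?X")
    and "(real (card V) - 2) * y_inv V E s t L =
      (\<Sum>e\<in>E. coef V E s t L e * y_inv (c e ` V) (E - {e}) (c e \<circ> s) (c e \<circ> t) L)" (is "?y = ?Y")
proof -
  obtain p where "p \<in> V" using metrized by (auto simp: metrized_graph_def)
  then obtain g where g: "green V E s t L p g" using green_exists by blast
  let ?P = "\<lambda>e. res s t g e / L e" and ?v = "real (card V)"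
  have "?Y = (\<Sum>e\<in>E. ?P e * y_inv (c e ` V) (E - {e}) (c e \<circ> s) (c e \<circ> t) L)"
    by (simp add: edge_val_green(3)[OF g])
  also have "\<dots> = (\<Sum>e\<in>E. \<Sum>x\<in>V. ?P e * contr g e x x)
      - (\<Sum>e\<in>E. \<Sum>f\<in>E. ?P e * minor (contr g e) f / L f) - (\<Sum>e\<in>E. minor g e / L e)"
    by (simp add: contract_inv(1)[OF g, folded c_def] sum_subtractf right_diff_distrib sum_distrib_left
        del: times_divide_eq_left)
  also have "(\<Sum>e\<in>E. \<Sum>x\<in>V. ?P e * contr g e x x) = (?v - 2) * (\<Sum>x\<in>V. g x x)"
    by (subst sum.swap) (simp add: contr_sum[OF g] sum_distrib_left del: times_divide_eq_left)
  also have "(\<Sum>e\<in>E. \<Sum>f\<in>E. ?P e * minor (contr g e) f / L f) = (?v - 3) * (\<Sum>f\<in>E. minor g f / L f)"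
  proof -
    have "(\<Sum>e\<in>E. \<Sum>f\<in>E. ?P e * minor (contr g e) f / L f) = (\<Sum>f\<in>E. (\<Sum>e\<in>E. ?P e * minor (contr g e) f) / L f)"
      by (subst sum.swap) (simp add: sum_divide_distrib)
    also have "\<dots> = (\<Sum>f\<in>E. (?v - 3) * minor g f / L f)"
      unfolding minor_def using ends by (intro sum.cong refl) (simp add: contr_minor_sum[OF g] del: times_divide_eq_left)
    finally show ?thesis by (simp add: sum_distrib_left)
  qed
  \<comment> \<open>The minors lost to contracted vertices complete the factor v-3 to v-2.\<close>
  also have "(?v - 2) * (\<Sum>x\<in>V. g x x) - (?v - 3) * (\<Sum>f\<in>E. minor g f / L f) - (\<Sum>e\<in>E. minor g e / L e) = ?y"
    unfolding inv_green(1)[OF g] y_green_trace[OF g] minor_def by (simp add: algebra_simps)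
  finally show y: "?y = ?Y" ..
  have "?X = (\<Sum>e\<in>E. ?P e * x_inv (c e ` V) (E - {e}) (c e \<circ> s) (c e \<circ> t) L)"
    by (simp add: edge_val_green(3)[OF g])
  also have "\<dots> = (\<Sum>e\<in>E. \<Sum>f\<in>E. ?P e * res s t (contr g e) f) - ?Y"
    by (simp add: contract_inv(2)[OF g, folded c_def] sum_subtractf sum_distrib_left edge_val_green(3)[OF g]
        del: times_divide_eq_left)
  \<comment> \<open>The total resistance is linear in g, so \<open>contr_sum\<close> scales it by
    v-2.\<close>
  also have "(\<Sum>e\<in>E. \<Sum>f\<in>E. ?P e * res s t (contr g e) f) = (\<Sum>f\<in>E. (?v - 2) * res s t g f)"
  proof (subst sum.swap, intro sum.cong refl)
    fix f assume "f \<in> E"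
    have "(\<Sum>e\<in>E. ?P e * res s t (contr g e) f) = (\<Sum>e\<in>E. ?P e * contr g e (s f) (s f))
        + (\<Sum>e\<in>E. ?P e * contr g e (t f) (t f)) - 2 * (\<Sum>e\<in>E. ?P e * contr g e (s f) (t f))"
      by (simp add: res_def[of s t "contr g _"] sum.distrib[symmetric] sum_subtractf[symmetric] sum_distrib_left
          algebra_simps del: times_divide_eq_left)
    then show "(\<Sum>e\<in>E. ?P e * res s t (contr g e) f) = (?v - 2) * res s t g f"
      using ends[OF \<open>f \<in> E\<close>]
      by (simp add: contr_sum[OF g] res_def[of s t g f] algebra_simps del: times_divide_eq_left)
  qed
  also have "(\<Sum>f\<in>E. (?v - 2) * res s t g f) - ?Y = ?x"
    unfolding y[symmetric] inv_green[OF g] by (simp add: sum_distrib_left right_diff_distrib)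
  finally show "?x = ?X" ..
qed

end

theorem theorem3p9:
  fixes V :: "'v set" and E :: "'e set" and s t :: "'e \<Rightarrow> 'v" and L :: "'e \<Rightarrow> real"
  assumes "metrized_graph V E s t L"
  shows "(real (card V) - 2) * x_inv V E s t L =
           (\<Sum>e\<in>E. coef V E s t L e *
              x_inv (cmap s t e ` V) (E - {e}) (cmap s t e \<circ> s) (cmap s t e \<circ> t) L)
       \<and> (real (card V) - 2) * y_inv V E s t L =
           (\<Sum>e\<in>E. coef V E s t L e *
              y_inv (cmap s t e ` V) (E - {e}) (cmap s t e \<circ> s) (cmap s t e \<circ> t) L)"
proof -
  interpret metrized V E s t L using assms by unfold_locales
  show ?thesis using contraction_identities by blast
qed

end
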